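(* Let $k$ be a field of characteristic zero and let $W$ be the Weyl algebra of index $1$ over $k$. If $P,Q\in W$ satisfy $[Q,P]=1$, then $\mathrm{Z}(P)=k[P]$.
   Context: The Weyl algebra $W$ of index $1$ over $k$ is the unital associative $k$-algebra generated by elements $X,Y$ subject to the relation $[Y,X]=1$, where $[A,B]:=AB-BA$. For $P\in W$, $\mathrm{Z}(P)$ denotes the centralizer of $P$, i.e. the subalgebra of all $R\in W$ with $PR=RP$. $k[P]$ denotes the $k$-subalgebra of $W$ generated by $P$. *)

theory Defs
  imports "HOL-Library.Poly_Mapping" "HOL-Computational_Algebra.Polynomial"
begin

section \<open>The free algebra on two generators\<close>

text \<open>
  Words are written additively because the convolution product of
  \<^typ>\<open>'a \<Rightarrow>\<^sub>0 'b\<close> is taken along the class \<^class>\<open>monoid_add\<close>; addition is concatenation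
  and is not commutative.  The free \<open>k\<close>-algebra on \<open>X\<close>, \<open>Y\<close> is the monoid algebra
  of the free monoid.
\<close>

datatype weyl_gen = GenX | GenY

datatype word = Word (letters: "weyl_gen list")

instantiation word :: monoid_add
begin

definition zero_word :: word where
  "zero_word = Word []"

definition plus_word :: "word \<Rightarrow> word \<Rightarrow> word" where
  "plus_word u v = Word (letters u @ letters v)"

instance
  by standard (simp_all add: zero_word_def plus_word_def)

end

type_synonym 'k free_alg = "word \<Rightarrow>\<^sub>0 'k"

definition free_gen :: "weyl_gen \<Rightarrow> 'k::field free_alg" where
  "free_gen g = Poly_Mapping.single (Word [g]) 1"

lemma free_alg_induct [case_names single add]:
  fixes f :: "'a \<Rightarrow>\<^sub>0 'k::comm_monoid_add"
  assumes single: "\<And>w c. P (Poly_Mapping.single w c)"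
    and add: "\<And>f g. P f \<Longrightarrow> P g \<Longrightarrow> P (f + g)"
  shows "P f"
proof -
  have fin: "P (\<Sum>w\<in>A. Poly_Mapping.single w (Poly_Mapping.lookup f w))" if "finite A" for A
    using that
  proof induction
    case empty
    have "P (Poly_Mapping.single undefined 0)" by (rule single)
    then show ?case by simp
  next
    case (insert w A)
    then show ?case by (simp add: single add)
  qed
  have "f = (\<Sum>w\<in>Poly_Mapping.keys f. Poly_Mapping.single w (Poly_Mapping.lookup f w))"
  proof (rule poly_mapping_eqI)
    fix v
    show "Poly_Mapping.lookup f v
      = Poly_Mapping.lookup (\<Sum>w\<in>Poly_Mapping.keys f. Poly_Mapping.single w (Poly_Mapping.lookup f w)) v"
      by (simp add: lookup_sum lookup_single when_def in_keys_iff)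
  qed
  then show ?thesis
    using fin[OF finite_keys, of f] by simp
qed

lemma scalar_commute:
  fixes f :: "'k::field free_alg"
  shows "Poly_Mapping.single 0 c * f = f * Poly_Mapping.single 0 c"
  by (induction f rule: free_alg_induct) (simp_all add: mult_single ac_simps distrib_left distrib_right)


section \<open>The ideal generated by the relation\<close>

definition two_sided_ideal :: "'a::ring_1 set \<Rightarrow> bool" where
  "two_sided_ideal I \<longleftrightarrow>
     0 \<in> I \<and> (\<forall>a\<in>I. \<forall>b\<in>I. a + b \<in> I) \<and> (\<forall>a\<in>I. \<forall>r. r * a \<in> I \<and> a * r \<in> I)"

definition commutator :: "'a::ring \<Rightarrow> 'a \<Rightarrow> 'a" where
  "commutator a b = a * b - b * a"

definition weyl_ideal :: "'k::field free_alg set" where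
  "weyl_ideal = two_sided_ideal hull {commutator (free_gen GenY) (free_gen GenX) - 1}"

lemma two_sided_ideal_weyl_ideal: "two_sided_ideal weyl_ideal"
  unfolding weyl_ideal_def
  by (rule hull_in) (auto simp: two_sided_ideal_def)

lemma weyl_ideal_0: "0 \<in> weyl_ideal"
  and weyl_ideal_add: "a \<in> weyl_ideal \<Longrightarrow> b \<in> weyl_ideal \<Longrightarrow> a + b \<in> weyl_ideal"
  and weyl_ideal_mult_left: "a \<in> weyl_ideal \<Longrightarrow> r * a \<in> weyl_ideal"
  and weyl_ideal_mult_right: "a \<in> weyl_ideal \<Longrightarrow> a * r \<in> weyl_ideal"
  using two_sided_ideal_weyl_ideal unfolding two_sided_ideal_def by blast+

lemma weyl_ideal_uminus: "a \<in> weyl_ideal \<Longrightarrow> - a \<in> weyl_ideal"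
  using weyl_ideal_mult_left[of a "- 1"] by simp

lemma weyl_ideal_relation: "commutator (free_gen GenY) (free_gen GenX) - 1 \<in> weyl_ideal"
  unfolding weyl_ideal_def by (rule hull_inc) simp

text \<open>
  The ideal is proper: \<open>X\<close> and \<open>Y\<close> act on \<open>k[x]\<close> as multiplication by \<open>x\<close> and as \<open>d/dx\<close>.
  This is needed only for the class \<^class>\<open>ring_1\<close>, which contains \<open>0 \<noteq> 1\<close>.
\<close>

fun gen_act :: "weyl_gen \<Rightarrow> 'k::field poly \<Rightarrow> 'k poly" where
  "gen_act GenX p = pCons 0 p"
| "gen_act GenY p = pderiv p"

definition word_act :: "word \<Rightarrow> 'k::field poly \<Rightarrow> 'k poly" where
  "word_act w = foldr gen_act (letters w)"

definition free_act :: "'k::field free_alg \<Rightarrow> 'k poly \<Rightarrow> 'k poly" where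
  "free_act f p = (\<Sum>w\<in>Poly_Mapping.keys f. smult (Poly_Mapping.lookup f w) (word_act w p))"

lemma gen_act_add: "gen_act g (p + q) = gen_act g p + gen_act g q"
  by (cases g) (simp_all add: pderiv_add)

lemma gen_act_smult: "gen_act g (smult c p) = smult c (gen_act g p)"
  by (cases g) (simp_all add: pderiv_smult)

lemma foldr_gen_act:
  "foldr gen_act gs (p + q) = foldr gen_act gs p + foldr gen_act gs q"
  "foldr gen_act gs (smult c p) = smult c (foldr gen_act gs p)"
  by (induction gs) (simp_all add: gen_act_add gen_act_smult)

lemma word_act_add: "word_act w (p + q) = word_act w p + word_act w q"
  and word_act_smult: "word_act w (smult c p) = smult c (word_act w p)"
  and word_act_plus: "word_act (v + w) p = word_act v (word_act w p)"
  and word_act_0: "word_act 0 p = p"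
  by (simp_all add: word_act_def foldr_gen_act plus_word_def zero_word_def)

lemma free_act_single: "free_act (Poly_Mapping.single w c) p = smult c (word_act w p)"
  by (simp add: free_act_def)

lemma free_act_add: "free_act (f + g) p = free_act f p + free_act g p"
  unfolding free_act_def
  by (rule setsum_keys_plus_distrib) (simp_all add: smult_add_left)

lemma free_act_linear:
  "free_act f (p + q) = free_act f p + free_act f q"
  "free_act f (smult c p) = smult c (free_act f p)"
  by (induction f rule: free_alg_induct)
    (simp_all add: free_act_single free_act_add word_act_add word_act_smult smult_add_right mult.commute)

lemma free_act_mult: "free_act (f * g) p = free_act f (free_act g p)"
proof (induction f arbitrary: p rule: free_alg_induct)
  case (single w c)
  show ?case
    by (induction g rule: free_alg_induct)
      (simp_all add: mult_single free_act_single free_act_add word_act_plus word_act_add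
        word_act_smult smult_add_right distrib_left)
next
  case (add f f')
  then show ?case by (simp add: free_act_add distrib_right)
qed

lemma free_act_0: "free_act 0 p = 0" and free_act_1: "free_act 1 p = p"
  using free_act_single[of 0 1 p] by (simp_all add: free_act_def word_act_0)

lemma free_act_diff: "free_act (f - g) p = free_act f p - free_act g p"
  using free_act_add[of "f - g" g p] by simp

lemma free_act_weyl_ideal:
  assumes "f \<in> weyl_ideal"
  shows "free_act f p = 0"
proof -
  have "weyl_ideal \<subseteq> {f :: 'a free_alg. \<forall>p. free_act f p = 0}"
    unfolding weyl_ideal_def
  proof (rule hull_minimal)
    have "free_act f 0 = 0" for f :: "'a free_alg"
      using free_act_linear(2)[of f 0 0] by simp
    then show "two_sided_ideal {f :: 'a free_alg. \<forall>p. free_act f p = 0}"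
      by (simp add: two_sided_ideal_def free_act_0 free_act_add free_act_mult)
    show "{commutator (free_gen GenY) (free_gen GenX) - 1} \<subseteq> {f :: 'a free_alg. \<forall>p. free_act f p = 0}"
      by (simp add: commutator_def free_act_diff free_act_mult free_act_1 free_gen_def
          free_act_single word_act_def pderiv_pCons)
  qed
  then show ?thesis using assms by blast
qed

lemma one_notin_weyl_ideal: "1 \<notin> weyl_ideal"
  using free_act_weyl_ideal[of 1 1] by (auto simp: free_act_1)


section \<open>The Weyl algebra\<close>

quotient_type (overloaded) 'k weyl = "'k::field free_alg" / "\<lambda>a b. a - b \<in> weyl_ideal"
proof (rule equivpI)
  show "reflp (\<lambda>a b :: 'k free_alg. a - b \<in> weyl_ideal)"
    by (rule reflpI) (simp add: weyl_ideal_0)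
  show "symp (\<lambda>a b :: 'k free_alg. a - b \<in> weyl_ideal)"
    by (rule sympI) (metis minus_diff_eq weyl_ideal_uminus)
  show "transp (\<lambda>a b :: 'k free_alg. a - b \<in> weyl_ideal)"
    by (rule transpI) (metis diff_add_cancel add_diff_eq weyl_ideal_add)
qed

lemma weyl_ideal_mult_cong:
  assumes "a - a' \<in> weyl_ideal" "b - b' \<in> weyl_ideal"
  shows "a * b - a' * b' \<in> weyl_ideal"
proof -
  have "a * b - a' * b' = (a - a') * b + a' * (b - b')"
    by (simp add: algebra_simps)
  then show ?thesis
    using assms by (simp add: weyl_ideal_add weyl_ideal_mult_left weyl_ideal_mult_right)
qed

instantiation weyl :: (field) ring_1
begin

lift_definition zero_weyl :: "'a weyl" is 0 .

lift_definition one_weyl :: "'a weyl" is 1 .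

lift_definition plus_weyl :: "'a weyl \<Rightarrow> 'a weyl \<Rightarrow> 'a weyl" is "(+)"
  by (metis add_diff_add weyl_ideal_add)

lift_definition uminus_weyl :: "'a weyl \<Rightarrow> 'a weyl" is uminus
  by (metis minus_diff_minus weyl_ideal_uminus)

lift_definition minus_weyl :: "'a weyl \<Rightarrow> 'a weyl \<Rightarrow> 'a weyl" is "(-)"
proof -
  fix a a' b b' :: "'a free_alg"
  assume "a - a' \<in> weyl_ideal" "b - b' \<in> weyl_ideal"
  then have "(a - a') + - (b - b') \<in> weyl_ideal"
    by (intro weyl_ideal_add weyl_ideal_uminus)
  then show "(a - b) - (a' - b') \<in> weyl_ideal"
    by (simp add: algebra_simps)
qed

lift_definition times_weyl :: "'a weyl \<Rightarrow> 'a weyl \<Rightarrow> 'a weyl" is "(*)"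
  by (rule weyl_ideal_mult_cong)

instance
proof
  show "(0 :: 'a weyl) \<noteq> 1"
    by transfer (metis diff_0 minus_minus one_notin_weyl_ideal weyl_ideal_uminus)
qed (transfer; simp add: algebra_simps weyl_ideal_0)+

end

lift_definition weyl_X :: "'k::field weyl" is "free_gen GenX" .

lift_definition weyl_Y :: "'k::field weyl" is "free_gen GenY" .

lemma weyl_relation: "commutator weyl_Y weyl_X = 1"
  unfolding commutator_def by transfer (use weyl_ideal_relation in \<open>simp add: commutator_def\<close>)

text \<open>The scalar \<open>c\<close> is \<open>c\<close> times the empty word.\<close>

lift_definition weyl_scale :: "'k::field \<Rightarrow> 'k weyl \<Rightarrow> 'k weyl" is
  "\<lambda>c f. Poly_Mapping.single 0 c * f"
  by (simp add: weyl_ideal_mult_left flip: right_diff_distrib)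

interpretation weyl: vector_space weyl_scale
  by standard
    (transfer; simp add: algebra_simps weyl_ideal_0 single_add mult_single flip: mult.assoc)+

lemma weyl_scale_mult:
  "weyl_scale c a * b = weyl_scale c (a * b)"
  "a * weyl_scale c b = weyl_scale c (a * b)"
  by (transfer; simp add: mult.assoc weyl_ideal_0)
    (transfer; simp add: scalar_commute weyl_ideal_0 mult.assoc)

definition weyl_subalgebra :: "'k::field weyl set \<Rightarrow> bool" where
  "weyl_subalgebra A \<longleftrightarrow> weyl.subspace A \<and> 1 \<in> A \<and> (\<forall>a\<in>A. \<forall>b\<in>A. a * b \<in> A)"

definition generated_subalgebra :: "'k::field weyl set \<Rightarrow> 'k weyl set" where
  "generated_subalgebra S = weyl_subalgebra hull S"

definition centralizer :: "'k::field weyl \<Rightarrow> 'k weyl set" where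
  "centralizer P = {R. P * R = R * P}"

end

theory Submission
  imports Defs
begin

text \<open>
  By the Jacobi identity, \<open>\<delta> = [Q, _]\<close> is a derivation of the centralizer \<open>Z(P)\<close> with
  \<open>\<delta> P = 1\<close>; on \<open>k[P]\<close> it is \<open>d/dP\<close>, which is onto in characteristic zero.  So it suffices that
  \<open>\<delta>\<close> be locally nilpotent on \<open>Z(P)\<close> with kernel \<open>k\<close>: then \<open>\<delta> R = f(P)\<close> by induction, and
  \<open>R\<close> differs from an antiderivative of \<open>f\<close> at \<open>P\<close> by a scalar.

  Elements are measured by their order in \<open>Y\<close>, with the coefficient of the highest power of
  \<open>Y\<close>, a polynomial in \<open>X\<close>, as symbol.  Symbols are multiplicative, and the symbol of a
  commutator is a Poisson bracket.  Hence if \<open>P\<close> has order \<open>m > 0\<close> and symbol \<open>a\<close>, and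
  \<open>R \<in> Z(P)\<close> has order \<open>r\<close> and symbol \<open>b\<close>, then \<open>m a b' = r b a'\<close>.  This makes \<open>b\<^sup>m\<close> a
  constant multiple of \<open>a\<^sup>r\<close>, that is, \<open>R\<^sup>m = c P\<^sup>r + S\<close> with \<open>S \<in> Z(P)\<close> of order less than
  \<open>r m\<close>.

  The central point is that \<open>\<delta>\<close> lowers the order on \<open>Z(P)\<close> by at least \<open>m\<close>
  (\<open>commutator_lowers_order\<close>).  It raises the order by a bounded amount, at most the order of
  \<open>Q\<close>.  Let \<open>e\<close> be its largest change, attained at \<open>R\<close>, and suppose \<open>e > - m\<close>.  In
  \<open>\<delta>(R\<^sup>m) = c r P\<^sup>r\<^sup>-\<^sup>1 + \<delta> S\<close> the left side has order \<open>r m + e\<close> exactly, whereas on the right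
  \<open>P\<^sup>r\<^sup>-\<^sup>1\<close> has order \<open>r m - m\<close> and \<open>\<delta> S\<close> has order less than \<open>r m + e\<close>: a contradiction.
  With \<open>e \<le> - m\<close> known, the same identity shows that \<open>\<delta> R = 0\<close> forces \<open>r = 0\<close>, and then
  \<open>m a b' = 0\<close> makes \<open>R\<close> a scalar.

  If \<open>P\<close> has order \<open>0\<close>, it is a polynomial in \<open>X\<close>, and \<open>[Q, P] = 1\<close> makes it linear.
  Then \<open>Z(P) = Z(X) = k[X] = k[P]\<close>.
\<close>

section \<open>Polynomials in one element\<close>

definition weyl_eval :: "'k::field weyl \<Rightarrow> 'k poly \<Rightarrow> 'k weyl" where
  "weyl_eval P f = fold_coeffs (\<lambda>c R. weyl_scale c 1 + P * R) f 0"

lemma weyl_eval_0 [simp]: "weyl_eval P 0 = 0"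
  by (simp add: weyl_eval_def)

lemma weyl_eval_pCons [simp]:
  "weyl_eval P (pCons c f) = weyl_scale c 1 + P * weyl_eval P f"
  by (cases "c = 0 \<and> f = 0") (auto simp: weyl_eval_def)

lemma weyl_eval_1 [simp]: "weyl_eval P 1 = 1"
  by (simp add: one_pCons)

lemma weyl_eval_add: "weyl_eval P (f + g) = weyl_eval P f + weyl_eval P g"
  by (induction f g rule: poly_induct2) (simp_all add: weyl.scale_left_distrib algebra_simps)

lemma weyl_eval_smult: "weyl_eval P (smult c f) = weyl_scale c (weyl_eval P f)"
  by (induction f) (simp_all add: weyl.scale_right_distrib weyl_scale_mult)

lemma weyl_eval_mult: "weyl_eval P (f * g) = weyl_eval P f * weyl_eval P g"
  by (induction f) (simp_all add: weyl_eval_add weyl_eval_smult weyl_scale_mult algebra_simps)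

lemma weyl_eval_pcompose: "weyl_eval P (pcompose f g) = weyl_eval (weyl_eval P g) f"
  by (induction f) (simp_all add: pcompose_pCons weyl_eval_add weyl_eval_mult)

lemma commute_weyl_eval:
  assumes "R * P = P * R"
  shows "R * weyl_eval P f = weyl_eval P f * R"
proof (induction f)
  case (pCons c f)
  have "R * (P * weyl_eval P f) = P * weyl_eval P f * R"
    by (metis assms mult.assoc pCons.IH)
  then show ?case
    by (simp add: distrib_left distrib_right weyl_scale_mult)
qed simp

section \<open>Commutators\<close>

lemma commutator_add_right: "commutator (a :: 'a::ring) (b + c) = commutator a b + commutator a c"
  and commutator_diff_right: "commutator (a :: 'a::ring) (b - c) = commutator a b - commutator a c"
  and commutator_mult_right: "commutator (a :: 'a::ring) (b * c) = commutator a b * c + b * commutator a c"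
  and commutator_0_right: "commutator (a :: 'a::ring) 0 = 0"
  and commutator_0_left: "commutator 0 (a :: 'a::ring) = 0"
  and commutator_minus: "commutator (a :: 'a::ring) b = - commutator b a"
  by (simp_all add: commutator_def algebra_simps)

lemma commutator_add_left: "commutator (b + c) (a :: 'a::ring) = commutator b a + commutator c a"
  and commutator_diff_left: "commutator (b - c) (a :: 'a::ring) = commutator b a - commutator c a"
  and commutator_mult_left: "commutator (b * c) (a :: 'a::ring) = commutator b a * c + b * commutator c a"
  by (simp_all add: commutator_def algebra_simps)

lemma commutator_jacobi:
  "commutator (commutator R S) (T :: 'a::ring) =
    commutator (commutator R T) S + commutator R (commutator S T)"
  by (simp add: commutator_def algebra_simps)

lemma commutator_scale_left: "commutator (weyl_scale c a) b = weyl_scale c (commutator a b)"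
  and commutator_scale_right: "commutator a (weyl_scale c b) = weyl_scale c (commutator a b)"
  by (simp_all add: commutator_def weyl_scale_mult weyl.scale_right_diff_distrib)

lemma commutator_1_right: "commutator (a :: 'a::ring_1) 1 = 0"
  by (simp add: commutator_def)

lemma commutator_1_left: "commutator 1 (a :: 'a::ring_1) = 0"
  by (simp add: commutator_def)

text \<open>
  This serves twice: for the pair \<open>(Y, X)\<close> it is the commutation rule of the Weyl algebra, and
  for \<open>(Q, P)\<close> it says that \<open>[Q, _]\<close> is \<open>d/dP\<close> on \<open>k[P]\<close>.
\<close>

lemma commutator_weyl_eval:
  assumes "commutator Q P = 1"
  shows "commutator Q (weyl_eval P f) = weyl_eval P (pderiv f)"
proof (induction f)
  case (pCons c f)
  then show ?case
    by (simp add: commutator_add_right commutator_scale_right commutator_1_right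
        commutator_mult_right assms pderiv_pCons weyl_eval_add)
qed (simp add: commutator_0_right)

section \<open>Normal forms\<close>

text \<open>
  In the action on \<open>k[x]\<close>, \<open>f(X)\<close> sends \<open>1\<close> to \<open>f\<close>; hence the powers of \<open>X\<close> are linearly
  independent.
\<close>

lift_definition weyl_act :: "'k::field weyl \<Rightarrow> 'k poly \<Rightarrow> 'k poly" is free_act
proof -
  fix f g :: "'k free_alg"
  assume "f - g \<in> weyl_ideal"
  then show "free_act f = free_act g"
    using free_act_weyl_ideal[of "f - g"] by (auto simp: free_act_diff)
qed

lemma weyl_act_add: "weyl_act (R + S) p = weyl_act R p + weyl_act S p"
  by transfer (rule free_act_add)

lemma weyl_act_mult: "weyl_act (R * S) p = weyl_act R (weyl_act S p)"
  by transfer (rule free_act_mult)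

lemma weyl_act_scale_one: "weyl_act (weyl_scale c 1) p = smult c p"
  by transfer (simp add: free_act_single word_act_0)

lemma weyl_act_X: "weyl_act weyl_X p = pCons 0 p"
  by transfer (simp add: free_gen_def free_act_single word_act_def)

lemma weyl_act_eval_X: "weyl_act (weyl_eval weyl_X f) 1 = f"
proof (induction f)
  case 0
  then show ?case by (simp add: zero_weyl.abs_eq weyl_act.abs_eq free_act_0)
next
  case (pCons c f)
  then show ?case by (simp add: weyl_act_add weyl_act_mult weyl_act_scale_one weyl_act_X one_pCons)
qed

lemma weyl_eval_X_inject [simp]: "weyl_eval weyl_X f = weyl_eval weyl_X g \<longleftrightarrow> f = g"
  by (metis weyl_act_eval_X)

lemma weyl_eval_X_eq_0 [simp]: "weyl_eval weyl_X f = 0 \<longleftrightarrow> f = 0"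
  using weyl_eval_X_inject[of f 0] by simp

text \<open>
  The outer variable of the polynomial stands for \<open>Y\<close> and the coefficients are polynomials in
  \<open>X\<close>, written to the left of the powers of \<open>Y\<close>.
\<close>

definition normal_form :: "'k::field poly poly \<Rightarrow> 'k weyl" where
  "normal_form p = fold_coeffs (\<lambda>a R. weyl_eval weyl_X a + R * weyl_Y) p 0"

lemma normal_form_0 [simp]: "normal_form 0 = 0"
  by (simp add: normal_form_def)

lemma normal_form_pCons [simp]:
  "normal_form (pCons a p) = weyl_eval weyl_X a + normal_form p * weyl_Y"
  by (cases "a = 0 \<and> p = 0") (auto simp: normal_form_def)

lemma normal_form_add: "normal_form (p + q) = normal_form p + normal_form q"
  by (induction p q rule: poly_induct2) (simp_all add: weyl_eval_add algebra_simps)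

lemma eval_mult_normal_form: "weyl_eval weyl_X a * normal_form p = normal_form (smult a p)"
  by (induction p) (simp_all add: weyl_eval_mult distrib_left flip: mult.assoc)

lemma Y_mult_normal_form: "\<exists>q. weyl_Y * normal_form p = normal_form q"
proof (induction p)
  case 0
  show ?case by (rule exI[of _ 0]) simp
next
  case (pCons a p)
  then obtain q where q: "weyl_Y * normal_form p = normal_form q" by blast
  have "weyl_Y * weyl_eval weyl_X a = weyl_eval weyl_X a * weyl_Y + weyl_eval weyl_X (pderiv a)"
    using commutator_weyl_eval[OF weyl_relation, of a] by (simp add: commutator_def algebra_simps)
  then have "weyl_Y * normal_form (pCons a p) = normal_form (pCons (pderiv a) ([:a:] + q))"
    using q by (simp add: distrib_left distrib_right normal_form_add flip: mult.assoc)
  then show ?case by blast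
qed

text \<open>
  The normal forms contain the scalars and are closed under multiplication by \<open>X\<close> and \<open>Y\<close> from
  the left, so they contain every word, by induction on its length.
\<close>

lemma normal_form_surj: "\<exists>p. R = normal_form p"
proof -
  obtain f where abs_weyl: "R = abs_weyl f" using Quotient_weyl Quotient_abs_rep by metis
  have "\<exists>p. abs_weyl f = normal_form p"
  proof (induction f rule: free_alg_induct)
    case (single w c)
    have "\<exists>p. abs_weyl (Poly_Mapping.single (Word gs) c) = normal_form p" for gs
    proof (induction gs)
      case Nil
      have "abs_weyl (Poly_Mapping.single (Word []) c) = weyl_scale c 1"
        by (simp add: one_weyl.abs_eq weyl_scale.abs_eq flip: zero_word_def)
      also have "\<dots> = normal_form [:[:c:]:]" by simp
      finally show ?case by blast
    next
      case (Cons g gs)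
      then obtain p where p: "abs_weyl (Poly_Mapping.single (Word gs) c) = normal_form p" by blast
      have "Poly_Mapping.single (Word (g # gs)) c = free_gen g * Poly_Mapping.single (Word gs) c"
        by (simp add: free_gen_def mult_single plus_word_def)
      then have *: "abs_weyl (Poly_Mapping.single (Word (g # gs)) c) = abs_weyl (free_gen g) * normal_form p"
        by (simp add: times_weyl.abs_eq flip: p)
      show ?case
      proof (cases g)
        case GenX
        have "weyl_X = weyl_eval weyl_X [:0, 1:]" by simp
        then show ?thesis
          using * GenX eval_mult_normal_form by (metis weyl_X.abs_eq)
      next
        case GenY
        then show ?thesis using * Y_mult_normal_form by (metis weyl_Y.abs_eq)
      qed
    qed
    then show ?case by (metis word.collapse)
  next
    case (add f g)
    then show ?case by (metis normal_form_add plus_weyl.abs_eq)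
  qed
  then show ?thesis using abs_weyl by simp
qed

lemma commutator_eval_X: "commutator (weyl_eval weyl_X a) weyl_X = 0"
  using commute_weyl_eval[of weyl_X weyl_X a] by (simp add: commutator_def)

lemma commutator_normal_form: "commutator (normal_form p) weyl_X = normal_form (pderiv p)"
  by (induction p)
    (simp_all add: commutator_0_left commutator_add_left commutator_mult_left commutator_eval_X
      weyl_relation pderiv_pCons normal_form_add algebra_simps)

lemma pderiv_eq_0E:
  fixes f :: "'a::{idom,ring_char_0} poly"
  assumes "pderiv f = 0"
  obtains c where "f = [:c:]"
  using assms by (metis pderiv_iszero)

text \<open>
  Since \<open>[_, X]\<close> acts on normal forms as \<open>d/dY\<close>, a vanishing normal form has a vanishing
  derivative by induction on the degree, and so reduces to a polynomial in \<open>X\<close>.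
\<close>

lemma normal_form_eq_0:
  fixes p :: "'k::field_char_0 poly poly"
  assumes "normal_form p = 0"
  shows "p = 0"
  using assms
proof (induction "degree p" arbitrary: p rule: less_induct)
  case less
  have *: "normal_form (pderiv p) = 0"
    using commutator_normal_form[of p] less.prems by (simp add: commutator_0_left)
  have "pderiv p = 0"
  proof (cases "degree p = 0")
    case True
    then show ?thesis by (simp add: pderiv_eq_0_iff)
  next
    case False
    then show ?thesis using less.hyps[OF _ *] by (simp add: degree_pderiv)
  qed
  then obtain a where "p = [:a:]" by (rule pderiv_eq_0E)
  then show ?case using less.prems by simp
qed

lemma commutes_with_X:
  fixes R :: "'k::field_char_0 weyl"
  assumes "commutator R weyl_X = 0"
  obtains a where "R = weyl_eval weyl_X a"
proof -
  obtain p where p: "R = normal_form p" using normal_form_surj by blast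
  then have "pderiv p = 0" using assms commutator_normal_form normal_form_eq_0 by metis
  then obtain a where "p = [:a:]" by (rule pderiv_eq_0E)
  then show thesis using that p by simp
qed

section \<open>Order and symbol\<close>

text \<open>
  In characteristic zero, \<open>has_symbol n R a\<close> means that \<open>R\<close> has order at most \<open>n\<close> in \<open>Y\<close> and that \<open>a\<close> is the coefficient
  of \<open>Y\<^sup>n\<close> in its normal form; so \<open>has_symbol n R 0\<close> means order less than \<open>n\<close>, and
  \<open>has_symbol 0 R 0\<close> means \<open>R = 0\<close>.  The recursion differentiates with respect to \<open>Y\<close>, in the form
  of the derivation \<open>[_, X]\<close>, which lets the product and commutator rules follow from the Leibniz
  rule by induction on the order, without reordering any words.
\<close>

fun has_symbol :: "nat \<Rightarrow> 'k::field weyl \<Rightarrow> 'k poly \<Rightarrow> bool" where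
  "has_symbol 0 R a \<longleftrightarrow> R = weyl_eval weyl_X a"
| "has_symbol (Suc n) R a \<longleftrightarrow> has_symbol n (commutator R weyl_X) (of_nat (Suc n) * a)"

declare has_symbol.simps(2) [simp del]

lemma has_symbol_add: "has_symbol n R a \<Longrightarrow> has_symbol n S b \<Longrightarrow> has_symbol n (R + S) (a + b)"
  by (induction n arbitrary: R S a b)
    (auto simp: weyl_eval_add has_symbol.simps(2) commutator_add_left distrib_left simp del: of_nat_Suc)

lemma has_symbol_scale: "has_symbol n R a \<Longrightarrow> has_symbol n (weyl_scale c R) (smult c a)"
  by (induction n arbitrary: R a)
    (auto simp: weyl_eval_smult has_symbol.simps(2) commutator_scale_left simp del: of_nat_Suc)

lemma has_symbol_diff: "has_symbol n R a \<Longrightarrow> has_symbol n S b \<Longrightarrow> has_symbol n (R - S) (a - b)"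
  using has_symbol_add[of n R a "weyl_scale (-1) S" "smult (-1) b"] has_symbol_scale[of n S b "-1"]
  by simp

lemma has_symbol_0: "has_symbol n 0 0"
  by (induction n) (auto simp: has_symbol.simps(2) commutator_0_left)

lemma has_symbol_Suc: "has_symbol n R a \<Longrightarrow> has_symbol (Suc n) R 0"
  by (induction n arbitrary: R a)
    (auto simp: has_symbol.simps(2) commutator_eval_X)

lemma has_symbol_less: "has_symbol n R a \<Longrightarrow> n < k \<Longrightarrow> has_symbol k R 0"
proof (induction k)
  case (Suc k)
  then show ?case using has_symbol_Suc by (metis less_Suc_eq)
qed simp

lemma has_symbol_0_mono: "has_symbol n R 0 \<Longrightarrow> n \<le> k \<Longrightarrow> has_symbol k R 0"
  using has_symbol_less by (metis le_neq_implies_less)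

lemma has_symbol_unique:
  fixes R :: "'k::field_char_0 weyl"
  shows "has_symbol n R a \<Longrightarrow> has_symbol n R b \<Longrightarrow> a = b"
proof (induction n arbitrary: R a b)
  case (Suc n)
  then have "of_nat (Suc n) * a = of_nat (Suc n) * b"
    unfolding has_symbol.simps(2) by blast
  then show ?case by (simp del: of_nat_Suc)
qed simp

text \<open>
  At order zero this uses that whatever commutes with \<open>X\<close> is a polynomial in \<open>X\<close>.
\<close>

lemma has_symbol_lower:
  fixes R :: "'k::field_char_0 weyl"
  assumes "has_symbol (Suc n) R 0"
  shows "\<exists>a. has_symbol n R a"
  using assms
proof (induction n arbitrary: R)
  case 0
  then have "commutator R weyl_X = 0" by (simp add: has_symbol.simps(2))
  then show ?case using commutes_with_X by (metis has_symbol.simps(1))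
next
  case (Suc n)
  then have "has_symbol (Suc n) (commutator R weyl_X) 0" by (simp add: has_symbol.simps(2)[of "Suc n"])
  then obtain a where a: "has_symbol n (commutator R weyl_X) a" using Suc.IH by blast
  have "of_nat (Suc n) * smult (1 / of_nat (Suc n)) a = a"
    by (simp add: of_nat_poly del: of_nat_Suc)
  then show ?case using a by (metis has_symbol.simps(2))
qed

lemma has_symbol_normal_form:
  fixes p :: "'k::field_char_0 poly poly"
  shows "degree p \<le> n \<Longrightarrow> has_symbol n (normal_form p) (coeff p n)"
proof (induction n arbitrary: p)
  case 0
  then obtain a where "p = [:a:]" by (metis degree_eq_zeroE le_zero_eq)
  then show ?case by simp
next
  case (Suc n)
  then have "degree (pderiv p) \<le> n"
    by (simp add: degree_pderiv)
  then show ?case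
    using Suc.IH[of "pderiv p"] by (simp add: has_symbol.simps(2) commutator_normal_form coeff_pderiv del: of_nat_Suc)
qed

lemma leading_symbol:
  fixes R :: "'k::field_char_0 weyl"
  assumes "R \<noteq> 0"
  obtains n a where "has_symbol n R a" "a \<noteq> 0"
proof -
  obtain p where p: "R = normal_form p" using normal_form_surj by blast
  then have "p \<noteq> 0" using assms by auto
  then show thesis using that[of "degree p" "lead_coeff p"] has_symbol_normal_form[of p] p by simp
qed

lemma leading_symbol_le:
  fixes R :: "'k::field_char_0 weyl"
  assumes "has_symbol n R a" "a \<noteq> 0" "has_symbol k R b"
  shows "n \<le> k"
  using assms has_symbol_less has_symbol_unique by (metis not_le)

lemma has_symbol_mult:
  "has_symbol n R a \<Longrightarrow> has_symbol m S b \<Longrightarrow> has_symbol (n + m) (R * S) (a * b)"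
proof (induction "n + m" arbitrary: n m R S a b)
  case 0
  then show ?case by (simp add: weyl_eval_mult)
next
  case (Suc k)
  have 1: "has_symbol k (commutator R weyl_X * S) (of_nat n * a * b)"
  proof (cases n)
    case 0
    then show ?thesis using Suc.prems by (simp add: commutator_eval_X has_symbol_0)
  next
    case (Suc n')
    then have "has_symbol (n' + m) (commutator R weyl_X * S) (of_nat n * a * b)"
      using Suc.prems Suc.hyps by (metis has_symbol.simps(2) add_Suc nat.inject)
    then show ?thesis using Suc \<open>Suc k = n + m\<close> by simp
  qed
  have 2: "has_symbol k (R * commutator S weyl_X) (a * (of_nat m * b))"
  proof (cases m)
    case 0
    then show ?thesis using Suc.prems by (simp add: commutator_eval_X has_symbol_0)
  next
    case (Suc m')
    then have "has_symbol (n + m') (R * commutator S weyl_X) (a * (of_nat m * b))"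
      using Suc.prems Suc.hyps by (metis has_symbol.simps(2) add_Suc_right nat.inject)
    then show ?thesis using Suc \<open>Suc k = n + m\<close> by simp
  qed
  have "of_nat n * a * b + a * (of_nat m * b) = of_nat (Suc k) * (a * b)"
    unfolding \<open>Suc k = n + m\<close> by (simp add: algebra_simps)
  then show ?case
    using has_symbol_add[OF 1 2] \<open>Suc k = n + m\<close>
    by (metis has_symbol.simps(2) commutator_mult_left)
qed

lemma has_symbol_1: "has_symbol 0 1 1"
  by simp

lemma has_symbol_power: "has_symbol n R a \<Longrightarrow> has_symbol (k * n) (R ^ k) (a ^ k)"
  by (induction k) (auto intro: has_symbol_mult)

section \<open>The symbol of a commutator\<close>

lemma has_symbol_eval_commutator:
  fixes S :: "'k::field_char_0 weyl"
  shows "has_symbol (Suc m) S b \<Longrightarrow>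
    has_symbol m (commutator S (weyl_eval weyl_X a)) (of_nat (Suc m) * b * pderiv a)"
proof (induction m arbitrary: S b)
  case 0
  \<comment> \<open>An element of order one is \<open>b Y + c\<close> with \<open>b, c \<in> k[X]\<close>.\<close>
  then have "commutator (S - weyl_eval weyl_X b * weyl_Y) weyl_X = 0"
    by (simp add: has_symbol.simps(2) commutator_diff_left commutator_mult_left commutator_eval_X weyl_relation)
  then obtain c where "S - weyl_eval weyl_X b * weyl_Y = weyl_eval weyl_X c"
    by (rule commutes_with_X)
  then have S: "S = weyl_eval weyl_X b * weyl_Y + weyl_eval weyl_X c" by (simp add: algebra_simps)
  have "commutator (weyl_eval weyl_X c) (weyl_eval weyl_X a) = 0" for c
    by (simp add: commutator_def mult.commute flip: weyl_eval_mult)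
  then show ?case
    unfolding S by (simp add: commutator_add_left commutator_mult_left
        commutator_weyl_eval[OF weyl_relation] weyl_eval_mult)
next
  case (Suc m)
  have "commutator (commutator S (weyl_eval weyl_X a)) weyl_X
      = commutator (commutator S weyl_X) (weyl_eval weyl_X a)"
    unfolding commutator_jacobi[of S "weyl_eval weyl_X a" weyl_X]
    by (simp only: commutator_eval_X commutator_0_right add_0_right)
  moreover have "has_symbol m (commutator (commutator S weyl_X) (weyl_eval weyl_X a))
      (of_nat (Suc m) * (of_nat (Suc (Suc m)) * b) * pderiv a)"
    using Suc.IH[of "commutator S weyl_X" "of_nat (Suc (Suc m)) * b"] Suc.prems
    unfolding has_symbol.simps(2)[of "Suc m"] by blast
  ultimately show ?case
    unfolding has_symbol.simps(2)[of m] by (simp only: mult.assoc)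
qed

lemma has_symbol_commutator_order_zero:
  fixes R S :: "'k::field_char_0 weyl"
  assumes R: "has_symbol n R a" and S: "has_symbol m S b" and nm: "n + m = Suc k" "n = 0 \<or> m = 0"
  shows "has_symbol k (commutator R S) (of_nat n * a * pderiv b - of_nat m * b * pderiv a)"
  using nm(2)
proof
  assume "n = 0"
  then have "has_symbol k (commutator S R) (of_nat m * b * pderiv a)"
    using R S nm has_symbol_eval_commutator[of k S b a] by simp
  then have "has_symbol k (0 - commutator S R) (0 - of_nat m * b * pderiv a)"
    by (rule has_symbol_diff[OF has_symbol_0])
  then show ?thesis
    using \<open>n = 0\<close> commutator_minus[of R S] by simp
next
  assume "m = 0"
  then show ?thesis
    using R S nm has_symbol_eval_commutator[of k R a b] by simp
qed

text \<open>
  This is the Poisson bracket of \<open>a Y\<^sup>n\<close> and \<open>b Y\<^sup>m\<close>: the leading terms commute, so the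
  commutator drops one order, and its symbol is found by applying \<open>[_, X]\<close>, which obeys the
  Jacobi identity, until one argument has order zero.
\<close>

lemma has_symbol_commutator:
  fixes R S :: "'k::field_char_0 weyl"
  shows "has_symbol n R a \<Longrightarrow> has_symbol m S b \<Longrightarrow> n + m = Suc k \<Longrightarrow>
    has_symbol k (commutator R S) (of_nat n * a * pderiv b - of_nat m * b * pderiv a)"
proof (induction k arbitrary: n m R S a b)
  case 0
  then have "n = 0 \<or> m = 0" by arith
  then show ?case using has_symbol_commutator_order_zero 0 by blast
next
  case (Suc k)
  show ?case
  proof (cases "n = 0 \<or> m = 0")
    case True
    then show ?thesis using has_symbol_commutator_order_zero Suc.prems by blast
  next
    case False
    then obtain n' m' where nm: "n = Suc n'" "m = Suc m'" by (metis not0_implies_Suc)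
    let ?s = "of_nat n' * (of_nat n * a) * pderiv b - of_nat m * b * pderiv (of_nat n * a)"
    let ?t = "of_nat n * a * pderiv (of_nat m * b) - of_nat m' * (of_nat m * b) * pderiv a"
    have 1: "has_symbol k (commutator (commutator R weyl_X) S) ?s"
      using Suc.prems nm by (intro Suc.IH) (simp_all add: has_symbol.simps(2))
    have 2: "has_symbol k (commutator R (commutator S weyl_X)) ?t"
      using Suc.prems nm by (intro Suc.IH) (simp_all add: has_symbol.simps(2))
    have "of_nat (Suc k) = (of_nat n' + of_nat m :: 'k poly)"
      "of_nat n = (1 + of_nat n' :: 'k poly)" "of_nat m = (1 + of_nat m' :: 'k poly)"
      using Suc.prems(3) nm by (simp_all flip: of_nat_add)
    then have "?s + ?t = of_nat (Suc k) * (of_nat n * a * pderiv b - of_nat m * b * pderiv a)"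
      by (simp add: pderiv_mult pderiv_add algebra_simps)
    then show ?thesis
      using has_symbol_add[OF 1 2]
      by (simp only: has_symbol.simps(2) commutator_jacobi[of R S weyl_X])
  qed
qed

section \<open>Proportional symbols\<close>

lemma lead_coeff_pderiv:
  fixes f :: "'a::field_char_0 poly"
  shows "lead_coeff (pderiv f) = of_nat (degree f) * lead_coeff f"
  by (cases "degree f") (auto simp: degree_pderiv coeff_pderiv pderiv_eq_0_iff elim: degree_eq_zeroE)

text \<open>
  Comparing leading coefficients in \<open>f' g = f g'\<close> shows that nonzero \<open>f\<close> and \<open>g\<close> have the same
  degree.  The difference \<open>h\<close> of \<open>f\<close> and the multiple of \<open>g\<close> with the same leading coefficient
  satisfies the equation as well, but has no term of that degree, so \<open>h = 0\<close>.
\<close>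

lemma wronskian_zero:
  fixes f g :: "'a::field_char_0 poly"
  assumes "pderiv f * g = f * pderiv g" "f \<noteq> 0" "g \<noteq> 0"
  obtains c where "c \<noteq> 0" "f = smult c g"
proof -
  have same_degree: "degree f = degree g"
    if "pderiv f * g = f * pderiv g" "f \<noteq> 0" "g \<noteq> 0" for f g :: "'a poly"
  proof -
    have "lead_coeff (pderiv f * g) = lead_coeff (f * pderiv g)" using that by simp
    then have "of_nat (degree f) * (lead_coeff f * lead_coeff g)
        = of_nat (degree g) * (lead_coeff f * lead_coeff g)"
      unfolding lead_coeff_mult lead_coeff_pderiv by (simp only: ac_simps)
    then show ?thesis using that by simp
  qed
  define h where "h = f - smult (lead_coeff f / lead_coeff g) g"
  have deg: "degree f = degree g" using same_degree assms by blast
  have "h = 0"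
  proof (rule ccontr)
    assume "h \<noteq> 0"
    have "pderiv h * g = h * pderiv g"
      by (simp add: h_def pderiv_diff pderiv_smult left_diff_distrib assms(1) mult.commute[of g "pderiv g"])
    then have "degree h = degree g" using same_degree \<open>h \<noteq> 0\<close> assms by blast
    moreover have "coeff h (degree g) = 0"
      using deg assms by (simp add: h_def)
    ultimately show False using \<open>h \<noteq> 0\<close> by (metis leading_coeff_0_iff)
  qed
  then show thesis using that[of "lead_coeff f / lead_coeff g"] assms by (simp add: h_def)
qed

lemma pderiv_power_mult: "pderiv (f ^ n) * f = of_nat n * f ^ n * pderiv (f :: 'a::idom poly)"
  by (induction n) (simp_all add: pderiv_mult algebra_simps)

text \<open>
  Vanishing of the Poisson bracket of the symbols says that \<open>b\<^sup>m\<close> and \<open>a\<^sup>r\<close> have the same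
  logarithmic derivative.
\<close>

lemma proportional_powers:
  fixes P R :: "'k::field_char_0 weyl"
  assumes "has_symbol m P a" "a \<noteq> 0" "m > 0" "has_symbol r R b" "b \<noteq> 0" "commutator R P = 0"
  obtains c where "c \<noteq> 0" "b ^ m = smult c (a ^ r)"
proof -
  obtain k where k: "r + m = Suc k" using \<open>m > 0\<close> by (cases m) auto
  have "of_nat r * b * pderiv a - of_nat m * a * pderiv b = 0"
    using has_symbol_commutator[OF assms(4,1) k] assms(6) has_symbol_0 has_symbol_unique by metis
  then have *: "of_nat r * b * pderiv a = of_nat m * a * pderiv b" by simp
  have "pderiv (b ^ m) * a ^ r * (a * b) = (pderiv (b ^ m) * b) * (a ^ r * a)" by (simp add: ac_simps)
  also have "\<dots> = b ^ m * a ^ r * (of_nat m * a * pderiv b)"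
    unfolding pderiv_power_mult by (simp add: ac_simps)
  also have "\<dots> = b ^ m * a ^ r * (of_nat r * b * pderiv a)" by (simp add: *)
  also have "\<dots> = b ^ m * b * (pderiv (a ^ r) * a)"
    unfolding pderiv_power_mult by (simp add: ac_simps)
  also have "\<dots> = b ^ m * pderiv (a ^ r) * (a * b)" by (simp add: ac_simps)
  \<comment> \<open>Cancelling the factor \<open>a b\<close>, which served to turn \<open>m\<close>-th and \<open>r\<close>-th powers into logarithmic
    derivatives, leaves a vanishing Wronskian.\<close>
  finally have "pderiv (b ^ m) * a ^ r = b ^ m * pderiv (a ^ r)"
    using assms by simp
  then obtain c where "c \<noteq> 0" "b ^ m = smult c (a ^ r)"
    by (rule wronskian_zero) (use assms in auto)
  then show thesis by (rule that)
qed

section \<open>The centralizer and the generated subalgebra\<close>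

lemma in_centralizer: "R \<in> centralizer P \<longleftrightarrow> commutator R P = 0"
  by (auto simp: centralizer_def commutator_def)

lemma centralizer_subalgebra: "weyl_subalgebra (centralizer P)"
  unfolding weyl_subalgebra_def weyl.subspace_def in_centralizer
  by (simp add: Ball_def in_centralizer commutator_add_left commutator_mult_left
      commutator_scale_left commutator_0_left commutator_1_left)

lemma subalgebra_power:
  assumes "weyl_subalgebra A" "R \<in> A"
  shows "R ^ n \<in> A"
  using assms by (induction n) (auto simp: weyl_subalgebra_def)

lemma weyl_eval_in_subalgebra:
  assumes "weyl_subalgebra A" "P \<in> A"
  shows "weyl_eval P f \<in> A"
proof -
  have A: "0 \<in> A" "\<And>R S. R \<in> A \<Longrightarrow> S \<in> A \<Longrightarrow> R + S \<in> A" "\<And>c R. R \<in> A \<Longrightarrow> weyl_scale c R \<in> A"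
    "1 \<in> A" "\<And>R S. R \<in> A \<Longrightarrow> S \<in> A \<Longrightarrow> R * S \<in> A"
    using assms(1) unfolding weyl_subalgebra_def weyl.subspace_def by auto
  show ?thesis by (induction f) (auto intro: A assms)
qed

lemma weyl_eval_in_generated: "weyl_eval P f \<in> generated_subalgebra {P}"
  unfolding generated_subalgebra_def hull_def
  using weyl_eval_in_subalgebra by blast

lemma generated_subset_centralizer: "generated_subalgebra {P} \<subseteq> centralizer P"
  unfolding generated_subalgebra_def
proof (rule hull_minimal)
  show "{P} \<subseteq> centralizer P" by (simp add: centralizer_def)
qed (rule centralizer_subalgebra)

lemma pderiv_sum: "pderiv (\<Sum>i\<in>I. f i) = (\<Sum>i\<in>I. pderiv (f i))"
  by (induction I rule: infinite_finite_induct) (simp_all add: pderiv_add)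

lemma pderiv_surj: "\<exists>g. pderiv g = (f :: 'a::field_char_0 poly)"
proof
  show "pderiv (\<Sum>i\<le>degree f. monom (coeff f i / of_nat (Suc i)) (Suc i)) = f"
    by (simp add: pderiv_sum pderiv_monom poly_as_sum_of_monoms del: of_nat_Suc)
qed

section \<open>Conjugate pairs of positive order\<close>

locale conjugate_pair =
  fixes P Q :: "'k::field_char_0 weyl" and m :: nat and a :: "'k poly"
  assumes QP: "commutator Q P = 1"
    and symP: "has_symbol m P a" and a: "a \<noteq> 0" and m: "m > 0"
begin

lemma commutator_in_centralizer: "R \<in> centralizer P \<Longrightarrow> commutator Q R \<in> centralizer P"
  unfolding in_centralizer commutator_jacobi[of Q R P] QP
  by (simp add: commutator_0_right commutator_1_left)

lemma commutator_power_P: "commutator Q (P ^ r) = of_nat r * P ^ (r - 1)"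
proof (induction r)
  case (Suc r)
  have "P * (of_nat r * P ^ (r - 1)) = of_nat r * P ^ r"
    by (cases r) (simp_all del: of_nat_Suc, metis mult.assoc mult_of_nat_commute)
  then show ?case using Suc by (simp add: commutator_mult_right QP algebra_simps)
qed (simp add: commutator_1_right)

lemma has_symbol_commutator_power:
  assumes "has_symbol r R b" "has_symbol k (commutator Q R) d"
  shows "has_symbol (n * r + k) (commutator Q (R ^ Suc n)) (of_nat (Suc n) * b ^ n * d)"
proof (induction n)
  case 0
  then show ?case using assms by simp
next
  case (Suc n)
  have "has_symbol (k + Suc n * r) (commutator Q R * R ^ Suc n) (d * b ^ Suc n)"
    using assms by (intro has_symbol_mult has_symbol_power)
  moreover have "has_symbol (r + (n * r + k)) (R * commutator Q (R ^ Suc n)) (b * (of_nat (Suc n) * b ^ n * d))"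
    by (intro has_symbol_mult assms Suc)
  ultimately have "has_symbol (Suc n * r + k) (commutator Q R * R ^ Suc n + R * commutator Q (R ^ Suc n))
     (d * b ^ Suc n + b * (of_nat (Suc n) * b ^ n * d))"
    by (intro has_symbol_add) (simp_all add: ac_simps)
  then show ?case
    unfolding power_Suc[of R "Suc n"] commutator_mult_right by (simp add: algebra_simps)
qed

lemma power_proportional_mod_lower:
  assumes "R \<in> centralizer P" "has_symbol r R b" "b \<noteq> 0"
  obtains c S where "c \<noteq> 0" "S \<in> centralizer P" "has_symbol (r * m) S 0" "R ^ m = weyl_scale c (P ^ r) + S"
proof -
  obtain c where c: "c \<noteq> 0" "b ^ m = smult c (a ^ r)"
    using proportional_powers[OF symP a m assms(2,3)] assms(1) by (auto simp: in_centralizer)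
  have "has_symbol (r * m) (R ^ m - weyl_scale c (P ^ r)) (b ^ m - smult c (a ^ r))"
    using has_symbol_power[OF assms(2), of m] has_symbol_power[OF symP, of r]
    by (intro has_symbol_diff has_symbol_scale) (simp_all add: ac_simps)
  moreover have "P \<in> centralizer P" by (simp add: centralizer_def)
  then have "commutator (R ^ m) P = 0" "commutator (P ^ r) P = 0"
    using subalgebra_power[OF centralizer_subalgebra] assms(1) in_centralizer by blast+
  ultimately show thesis
    using that[of c "R ^ m - weyl_scale c (P ^ r)"] c
    by (simp add: in_centralizer commutator_diff_left commutator_scale_left)
qed

text \<open>
  \<open>shift_bound t\<close> says that \<open>[Q, _]\<close> changes orders on the centralizer by at most \<open>t - m\<close>.
  Truncation of the subtraction is harmless: order less than \<open>0\<close> would mean that the commutator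
  vanishes, and so does order less than the truncated value \<open>0\<close>.
\<close>

definition shift_bound :: "nat \<Rightarrow> bool" where
  "shift_bound t \<longleftrightarrow> (\<forall>R\<in>centralizer P. \<forall>n. has_symbol n R 0 \<longrightarrow> has_symbol (n + t - m) (commutator Q R) 0)"

lemma shift_bound_exists: "\<exists>t. shift_bound t"
proof -
  have "Q \<noteq> 0" using QP by (auto simp: commutator_0_left)
  then obtain q d where q: "has_symbol q Q d" by (rule leading_symbol)
  have "has_symbol (n + (q + m) - m) (commutator Q R) 0" if "has_symbol n R 0" for n R
  proof -
    have "has_symbol (q + n) (Q * R) 0" "has_symbol (q + n) (R * Q) 0"
      using has_symbol_mult[OF q that] has_symbol_mult[OF that q] by (simp_all add: add.commute)
    then have "has_symbol (q + n) (Q * R - R * Q) (0 - 0)" by (rule has_symbol_diff)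
    then show ?thesis by (simp add: commutator_def add.commute)
  qed
  then show ?thesis unfolding shift_bound_def by blast
qed

lemma commutator_relation:
  assumes "R ^ m = weyl_scale c (P ^ r) + S"
  shows "commutator Q (R ^ m) = weyl_scale c (of_nat r * P ^ (r - 1)) + commutator Q S"
  by (simp add: assms commutator_add_right commutator_scale_right commutator_power_P)

lemma has_symbol_of_nat: "has_symbol n R b \<Longrightarrow> has_symbol n (of_nat r * R) (of_nat r * b)"
proof (induction r)
  case (Suc r)
  then have "has_symbol n (R + of_nat r * R) (b + of_nat r * b)" by (intro has_symbol_add)
  then show ?case by (simp add: distrib_right)
qed (simp add: has_symbol_0)

lemma has_symbol_commutator_power_P:
  "has_symbol ((r - 1) * m) (weyl_scale c (of_nat r * P ^ (r - 1))) (smult c (of_nat r * a ^ (r - 1)))"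
  by (intro has_symbol_scale has_symbol_of_nat has_symbol_power symP)

text \<open>
  Let \<open>d\<close> be the symbol of \<open>[Q, R]\<close> at the largest order that \<open>shift_bound (Suc t)\<close> permits; the
  claim is \<open>d = 0\<close>.  Now \<open>[Q, R\<^sup>m]\<close> has symbol \<open>m b\<^sup>m\<^sup>-\<^sup>1 d\<close> at order \<open>N\<close>.  But \<open>R\<^sup>m = c P\<^sup>r + S\<close>,
  and both \<open>[Q, S]\<close>, because \<open>S\<close> has order less than \<open>r m\<close>, and \<open>[Q, P\<^sup>r] = r P\<^sup>r\<^sup>-\<^sup>1\<close> have order
  less than \<open>N\<close>.
\<close>

lemma shift_bound_descent:
  assumes "shift_bound (Suc t)"
  shows "shift_bound t"
  unfolding shift_bound_def
proof (intro ballI allI impI)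
  fix R n assume R: "R \<in> centralizer P" "has_symbol n R 0"
  show "has_symbol (n + t - m) (commutator Q R) 0"
  proof (cases "R = 0")
    case True
    then show ?thesis by (simp add: commutator_0_right has_symbol_0)
  next
    case False
    then obtain r b where r: "has_symbol r R b" "b \<noteq> 0" by (rule leading_symbol)
    have "r < n"
      using leading_symbol_le[OF r R(2)] has_symbol_unique[OF r(1)] R(2) r(2) by (metis le_neq_implies_less)
    have bound: "has_symbol (Suc r + Suc t - m) (commutator Q R) 0"
      using assms R(1) has_symbol_Suc[OF r(1)] unfolding shift_bound_def by blast
    have "has_symbol (Suc r + t - m) (commutator Q R) 0"
    proof (cases "Suc r + t < m")
      case True
      \<comment> \<open>Both bounds are truncated to \<open>0\<close>.\<close>
      then show ?thesis using bound by simp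
    next
      case False
      define k where "k = Suc r + t - m"
      have k: "Suc r + Suc t - m = Suc k" "k + m = Suc r + t" using False by (auto simp: k_def)
      obtain d where d: "has_symbol k (commutator Q R) d"
        using bound has_symbol_lower unfolding k by blast
      obtain c S where S: "S \<in> centralizer P" "has_symbol (r * m) S 0"
        and rel: "R ^ m = weyl_scale c (P ^ r) + S"
        using power_proportional_mod_lower[OF R(1) r] by blast
      define N where "N = (m - 1) * r + k"
      have N: "N = r * m + Suc t - m"
        using k(2) m unfolding N_def by (cases m) (auto simp: algebra_simps)
      have "has_symbol N (commutator Q S) 0"
        using assms S unfolding shift_bound_def N by blast
      moreover have "has_symbol N (weyl_scale c (of_nat r * P ^ (r - 1))) 0"
      proof (cases "r = 0")
        case False
        have "(r - 1) * m < N" using False unfolding N by (cases r) auto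
        then show ?thesis using has_symbol_commutator_power_P has_symbol_less by blast
      qed (simp add: has_symbol_0)
      ultimately have "has_symbol N (commutator Q (R ^ m)) 0"
        unfolding commutator_relation[OF rel] using has_symbol_add by fastforce
      moreover have "has_symbol N (commutator Q (R ^ m)) (of_nat m * b ^ (m - 1) * d)"
        using has_symbol_commutator_power[OF r(1) d, of "m - 1"] m by (simp add: N_def)
      ultimately have "of_nat m * b ^ (m - 1) * d = 0" using has_symbol_unique by blast
      then have "d = 0" using m r(2) by simp
      then show ?thesis using d k_def by simp
    qed
    then show ?thesis by (rule has_symbol_0_mono) (use \<open>r < n\<close> in simp)
  qed
qed

lemma commutator_lowers_order:
  assumes "R \<in> centralizer P" "has_symbol n R 0"
  shows "has_symbol (n - m) (commutator Q R) 0"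
proof -
  obtain t where "shift_bound t" using shift_bound_exists by blast
  then have "shift_bound 0" by (induction t) (auto intro: shift_bound_descent)
  then show ?thesis using assms by (simp add: shift_bound_def)
qed

text \<open>
  If \<open>R\<close> had order \<open>r > 0\<close>, then in \<open>0 = [Q, R\<^sup>m] = c r P\<^sup>r\<^sup>-\<^sup>1 + [Q, S]\<close> the term \<open>[Q, S]\<close> would
  have smaller order than \<open>P\<^sup>r\<^sup>-\<^sup>1\<close>.  So \<open>R\<close> is a polynomial in \<open>X\<close>, and commuting with \<open>P\<close>, of
  positive order, makes it constant.
\<close>

lemma commuting_pair_scalar:
  assumes "R \<in> centralizer P" "commutator Q R = 0"
  obtains c where "R = weyl_scale c 1"
proof (cases "R = 0")
  case True
  then show thesis using that[of 0] by simp
next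
  case False
  then obtain r b where r: "has_symbol r R b" "b \<noteq> 0" by (rule leading_symbol)
  have Q0: "commutator Q (R ^ n) = 0" for n
    by (induction n) (simp_all add: assms(2) commutator_1_right commutator_mult_right)
  obtain c S where c: "c \<noteq> 0" and S: "S \<in> centralizer P" "has_symbol (r * m) S 0"
    and rel: "R ^ m = weyl_scale c (P ^ r) + S"
    using power_proportional_mod_lower[OF assms(1) r] by blast
  have "r = 0"
  proof (rule ccontr)
    assume "r \<noteq> 0"
    then have eq: "r * m - m = (r - 1) * m" by (simp add: diff_mult_distrib)
    have "has_symbol ((r - 1) * m) (commutator Q S) 0"
      using commutator_lowers_order[OF S] eq by simp
    then have "has_symbol ((r - 1) * m) (commutator Q (R ^ m)) (smult c (of_nat r * a ^ (r - 1)))"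
      unfolding commutator_relation[OF rel] using has_symbol_add[OF has_symbol_commutator_power_P] by fastforce
    then have "smult c (of_nat r * a ^ (r - 1)) = 0"
      unfolding Q0 using has_symbol_0 has_symbol_unique by blast
    then show False using c a \<open>r \<noteq> 0\<close> by simp
  qed
  obtain k where k: "m = Suc k" using m by (cases m) auto
  have "has_symbol k (commutator P R) (of_nat (Suc k) * a * pderiv b)"
    using has_symbol_eval_commutator[of k P a b] symP r(1) \<open>r = 0\<close> k by simp
  moreover have "commutator P R = 0" using assms(1) by (simp add: centralizer_def commutator_def)
  ultimately have "of_nat (Suc k) * a * pderiv b = 0" using has_symbol_0 has_symbol_unique by metis
  then have "pderiv b = 0" using a by (simp del: of_nat_Suc)
  then obtain e where "b = [:e:]" by (rule pderiv_eq_0E)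
  then show thesis using that[of e] r(1) \<open>r = 0\<close> by simp
qed

text \<open>Here \<open>m > 0\<close> makes the induction on the order terminate.\<close>

lemma centralizer_eval: "R \<in> centralizer P \<Longrightarrow> has_symbol n R 0 \<Longrightarrow> \<exists>f. R = weyl_eval P f"
proof (induction n arbitrary: R rule: less_induct)
  case (less n)
  show ?case
  proof (cases "n = 0")
    case True
    then show ?thesis using less.prems(2) by (metis has_symbol.simps(1) weyl_eval_0)
  next
    case False
    then obtain f where f: "commutator Q R = weyl_eval P f"
      using less.IH[OF _ commutator_in_centralizer[OF less.prems(1)] commutator_lowers_order[OF less.prems]] m
      by auto
    obtain g where g: "pderiv g = f" using pderiv_surj by blast
    have "commutator (weyl_eval P g) P = 0"
      using commute_weyl_eval[of P P g] by (simp add: commutator_def)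
    then have "R - weyl_eval P g \<in> centralizer P"
      using less.prems(1) by (simp add: in_centralizer commutator_diff_left)
    moreover have "commutator Q (R - weyl_eval P g) = 0"
      by (simp add: commutator_diff_right commutator_weyl_eval[OF QP] f g)
    ultimately obtain c where "R - weyl_eval P g = weyl_scale c 1" by (rule commuting_pair_scalar)
    then have "R = weyl_eval P ([:c:] + g)" by (simp add: weyl_eval_add algebra_simps)
    then show ?thesis by blast
  qed
qed

end

section \<open>Order zero and conclusion\<close>

text \<open>
  For \<open>P = a(X)\<close> and \<open>Q\<close> of order \<open>q\<close> with symbol \<open>d\<close>, the commutator \<open>[Q, P]\<close> has symbol
  \<open>q d a'\<close> at order \<open>q - 1\<close>.  As this commutator is \<open>1\<close>, \<open>q = 1\<close> and \<open>d a' = 1\<close>, so \<open>a\<close> is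
  linear and \<open>X\<close> is a polynomial in \<open>P\<close>.
\<close>

lemma centralizer_order_zero:
  fixes P Q :: "'k::field_char_0 weyl"
  assumes QP: "commutator Q P = 1" and P: "P = weyl_eval weyl_X a" and R: "R \<in> centralizer P"
  shows "\<exists>f. R = weyl_eval P f"
proof -
  have nz: "pderiv a \<noteq> 0"
  proof
    assume "pderiv a = 0"
    then obtain c where "a = [:c:]" by (rule pderiv_eq_0E)
    then show False using QP P by (simp add: commutator_scale_right commutator_1_right)
  qed
  have drop: "has_symbol k (commutator S P) (of_nat (Suc k) * d * pderiv a)" if "has_symbol (Suc k) S d" for k S d
    using has_symbol_eval_commutator[OF that, of a] by (simp add: P)
  obtain q d where q: "has_symbol q Q d" "d \<noteq> 0"
    using QP by (metis leading_symbol commutator_0_left zero_neq_one)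
  have "q = 1"
  proof (rule ccontr)
    assume "q \<noteq> 1"
    then consider "q = 0" | k where "q = Suc (Suc k)" by (metis One_nat_def not0_implies_Suc)
    then show False
    proof cases
      case 1
      then have "commutator Q P = 0" using q P by (simp add: commutator_def mult.commute flip: weyl_eval_mult)
      then show False using QP by simp
    next
      case 2
      have "has_symbol (Suc k) (1 :: 'k weyl) 0" using has_symbol_less[OF has_symbol_1, of "Suc k"] by simp
      then have "of_nat (Suc (Suc k)) * d * pderiv a = 0"
        using drop[of "Suc k" Q d] q 2 QP has_symbol_unique by metis
      then show False using q nz by (simp del: of_nat_Suc)
    qed
  qed
  then have "weyl_eval weyl_X (d * pderiv a) = 1" using drop[of 0 Q d] q QP by simp
  then have "d * pderiv a = 1" by (metis weyl_eval_1 weyl_eval_X_inject)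
  then have "degree (pderiv a) = 0" using nz q by (metis degree_1 degree_mult_eq add_is_0)
  then have "degree a \<le> 1" by (simp add: degree_pderiv)
  then obtain u v where uv: "a = [:u, v:]"
    by (cases a rule: pCons_cases) (auto elim!: degree_eq_zeroE split: if_splits)
  have v: "v \<noteq> 0" using nz by (auto simp: uv pderiv_pCons)
  have X: "weyl_X = weyl_eval P [:- u / v, 1 / v:]"
    using v by (simp add: P uv weyl_scale_mult weyl.scale_right_distrib flip: weyl.scale_left_distrib)
  have "commutator R weyl_X = 0"
    using commute_weyl_eval[of R P "[:- u / v, 1 / v:]"] R unfolding X
    by (simp add: centralizer_def commutator_def)
  then obtain b where "R = weyl_eval weyl_X b" by (rule commutes_with_X)
  then have "R = weyl_eval P (pcompose b [:- u / v, 1 / v:])"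
    by (simp only: weyl_eval_pcompose X[symmetric])
  then show ?thesis by blast
qed

theorem theorem2p11:
  fixes P Q :: "'k::field_char_0 weyl"
  assumes "commutator Q P = 1"
  shows "centralizer P = generated_subalgebra {P}"
proof
  show "generated_subalgebra {P} \<subseteq> centralizer P" by (rule generated_subset_centralizer)
  have "P \<noteq> 0" using assms by (auto simp: commutator_0_right)
  then obtain m a where P: "has_symbol m P a" "a \<noteq> 0" by (rule leading_symbol)
  show "centralizer P \<subseteq> generated_subalgebra {P}"
  proof
    fix R assume R: "R \<in> centralizer P"
    have "\<exists>f. R = weyl_eval P f"
    proof (cases "m = 0")
      case True
      then show ?thesis using centralizer_order_zero[OF assms _ R] P by simp
    next
      case False
      then interpret conjugate_pair P Q m a by unfold_locales (use assms P False in auto)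
      have "\<exists>n. has_symbol n R 0"
        using leading_symbol[of R] has_symbol_Suc has_symbol_0 by metis
      then show ?thesis using centralizer_eval[OF R] by blast
    qed
    then show "R \<in> generated_subalgebra {P}" using weyl_eval_in_generated by auto
  qed
qed

end
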